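(* Assume Martin's axiom for countable posets. Then there exists a $\mathcal{W}$-ultrafilter on $\omega$ which is not a $Q$-point.
   Context: Martin's axiom for countable posets: for every countable partially ordered set $P$ and every family $\mathcal{D}$ of fewer than $\mathfrak{c}$ dense subsets of $P$, there is a filter on $P$ meeting every member of $\mathcal{D}$. A set $A\subseteq\omega$ is an AP-set if it contains arithmetic progressions of arbitrary finite length; the van der Waerden ideal $\mathcal{W}$ is the ideal of all subsets of $\omega$ that are not AP-sets. An ultrafilter $\mathcal{U}$ on $\omega$ is a $\mathcal{W}$-ultrafilter if for every function $f:\omega\to\omega$ there exists $U\in\mathcal{U}$ with $f[U]\in\mathcal{W}$. An ultrafilter $\mathcal{U}$ on $\omega$ is a $Q$-point if for every partition $\{Q_n:n\in\omega\}$ of $\omega$ into finite sets there exists $A\in\mathcal{U}$ with $|A\cap Q_n|\le 1$ for every $n\in\omega$. *)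

theory Defs
  imports Complex_Main "HOL-Library.Equipollence" "HOL-Library.Disjoint_Sets"
begin

text \<open>Throughout, a poset is a carrier \<open>P\<close> with a relation \<open>r\<close> satisfying
  \<^prop>\<open>partial_order_on P r\<close>, where \<open>(p, q) \<in> r\<close> means \<open>p \<le> q\<close>; following the forcing
  convention, dense sets are dense downwards and filters are closed upwards.\<close>

definition poset_dense :: "'a set \<Rightarrow> 'a rel \<Rightarrow> 'a set \<Rightarrow> bool" where
  "poset_dense P r D \<longleftrightarrow> D \<subseteq> P \<and> (\<forall>p\<in>P. \<exists>d\<in>D. (d, p) \<in> r)"

definition poset_filter :: "'a set \<Rightarrow> 'a rel \<Rightarrow> 'a set \<Rightarrow> bool" where
  "poset_filter P r G \<longleftrightarrow> G \<subseteq> P \<and> G \<noteq> {} \<and>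
     (\<forall>p\<in>G. \<forall>q\<in>P. (p, q) \<in> r \<longrightarrow> q \<in> G) \<and>
     (\<forall>p\<in>G. \<forall>q\<in>G. \<exists>s\<in>G. (s, p) \<in> r \<and> (s, q) \<in> r)"

definition MA_poset :: "'a set \<Rightarrow> 'a rel \<Rightarrow> bool" where
  "MA_poset P r \<longleftrightarrow>
     (\<forall>\<D>. \<D> \<prec> (UNIV :: real set) \<and> (\<forall>D\<in>\<D>. poset_dense P r D) \<longrightarrow>
        (\<exists>G. poset_filter P r G \<and> (\<forall>D\<in>\<D>. G \<inter> D \<noteq> {})))"

text \<open>Martin's axiom for countable posets. A formula cannot quantify over types, so the posets
  range over those whose carrier is a set of natural numbers. Every countable poset is isomorphic
  to one of these; \<open>MA_countable_poset\<close> below recovers the axiom for countable posets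
  over an arbitrary type. Posets are nonempty, since the empty one has no (nonempty) filter.\<close>

definition MA_countable :: bool where
  "MA_countable \<longleftrightarrow>
     (\<forall>(P :: nat set) r. P \<noteq> {} \<and> partial_order_on P r \<longrightarrow> MA_poset P r)"

lemma MA_countable_poset:
  fixes P :: "'a set"
  assumes MA: MA_countable and "countable P" "P \<noteq> {}" and po: "partial_order_on P r"
  shows "MA_poset P r"
  unfolding MA_poset_def
proof (intro allI impI, elim conjE)
  fix \<D> :: "'a set set"
  assume small: "\<D> \<prec> (UNIV :: real set)" and dense: "\<forall>D\<in>\<D>. poset_dense P r D"
  define h where "h = to_nat_on P"
  have inj: "inj_on h P" unfolding h_def using assms(2) by (rule inj_on_to_nat_on)
  define r' where "r' = {(h p, h q) |p q. (p, q) \<in> r}"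
  have rP: "r \<subseteq> P \<times> P"
    using po by (auto simp: order_on_defs refl_on_def)
  have r': "(h p, h q) \<in> r' \<longleftrightarrow> (p, q) \<in> r" if "p \<in> P" "q \<in> P" for p q
    using that rP inj unfolding r'_def by (auto dest: inj_onD)
  have "partial_order_on (h ` P) r'"
    unfolding order_on_defs
  proof (intro conjI)
    show "r' \<subseteq> h ` P \<times> h ` P" using rP by (auto simp: r'_def)
    show "refl_on (h ` P) r'"
      using po r' by (auto simp: order_on_defs refl_on_def)
    show "trans r'"
    proof (rule transI)
      fix x y z assume "(x, y) \<in> r'" "(y, z) \<in> r'"
      then obtain p q q' s where *: "x = h p" "y = h q" "(p, q) \<in> r" "y = h q'" "z = h s" "(q', s) \<in> r"
        by (auto simp: r'_def)
      moreover have "q = q'" using * rP inj by (auto dest: inj_onD)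
      moreover have "trans r" using po by (simp add: order_on_defs)
      ultimately show "(x, z) \<in> r'" by (auto simp: r'_def dest: transD)
    qed
    show "antisym r'"
    proof (rule antisymI)
      fix x y assume "(x, y) \<in> r'" "(y, x) \<in> r'"
      moreover from this(1) obtain p q where "x = h p" "y = h q" "(p, q) \<in> r"
        unfolding r'_def by blast
      ultimately have *: "x = h p" "y = h q" "(p, q) \<in> r" "(h q, h p) \<in> r'" by auto
      have "(q, p) \<in> r" using * rP r' by blast
      moreover have "antisym r" using po by (simp add: order_on_defs)
      ultimately show "x = y" using * by (auto dest: antisymD)
    qed
  qed
  then have "MA_poset (h ` P) r'"
    using MA \<open>P \<noteq> {}\<close> by (simp add: MA_countable_def)
  moreover have "(`) h ` \<D> \<prec> (UNIV :: real set)"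
    using small image_lepoll lesspoll_trans1 by blast
  moreover have "\<forall>D\<in>(`) h ` \<D>. poset_dense (h ` P) r' D"
    using dense r' unfolding poset_dense_def by (fastforce simp: subset_iff)
  ultimately obtain G where G: "poset_filter (h ` P) r' G" and meet: "\<forall>D\<in>\<D>. G \<inter> h ` D \<noteq> {}"
    unfolding MA_poset_def by (metis imageI)
  let ?G = "{p \<in> P. h p \<in> G}"
  have img: "\<exists>p\<in>P. x = h p \<and> p \<in> ?G" if "x \<in> G" for x
    using that G by (auto simp: poset_filter_def)
  have "poset_filter P r ?G"
    unfolding poset_filter_def
  proof (intro conjI ballI impI)
    show "?G \<noteq> {}" using G img unfolding poset_filter_def by blast
  next
    fix p q assume "p \<in> ?G" "q \<in> P" "(p, q) \<in> r"
    then show "q \<in> ?G" using G r' unfolding poset_filter_def by blast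
  next
    fix p q assume pq: "p \<in> ?G" "q \<in> ?G"
    then obtain x where "x \<in> G" "(x, h p) \<in> r'" "(x, h q) \<in> r'"
      using G unfolding poset_filter_def by blast
    then show "\<exists>s\<in>?G. (s, p) \<in> r \<and> (s, q) \<in> r" using img r' pq by blast
  qed blast
  moreover have "\<forall>D\<in>\<D>. ?G \<inter> D \<noteq> {}"
    using meet dense unfolding poset_dense_def by blast
  ultimately show "\<exists>G. poset_filter P r G \<and> (\<forall>D\<in>\<D>. G \<inter> D \<noteq> {})" by blast
qed

definition AP_set :: "nat set \<Rightarrow> bool" where
  "AP_set A \<longleftrightarrow> (\<forall>k. \<exists>a d. d > 0 \<and> (\<forall>i<k. a + i * d \<in> A))"

definition vdW_ideal :: "nat set set" where
  "vdW_ideal = {A. \<not> AP_set A}"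

text \<open>An ultrafilter on \<open>\<omega>\<close> is represented by the library type of filters; a set \<open>A\<close> belongs
  to it iff \<open>\<forall>\<^sub>F n in \<U>. n \<in> A\<close>. That type includes the improper filter \<^term>\<open>bot\<close>, which
  must be excluded. Principal ultrafilters are permitted, but each of them is a Q-point.\<close>

definition is_ultrafilter :: "'a filter \<Rightarrow> bool" where
  "is_ultrafilter \<U> \<longleftrightarrow> \<U> \<noteq> bot \<and>
     (\<forall>A. (\<forall>\<^sub>F x in \<U>. x \<in> A) \<or> (\<forall>\<^sub>F x in \<U>. x \<in> - A))"

definition W_ultrafilter :: "nat filter \<Rightarrow> bool" where
  "W_ultrafilter \<U> \<longleftrightarrow> is_ultrafilter \<U> \<and>
     (\<forall>f :: nat \<Rightarrow> nat. \<exists>U. (\<forall>\<^sub>F n in \<U>. n \<in> U) \<and> f ` U \<in> vdW_ideal)"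

definition Q_point :: "nat filter \<Rightarrow> bool" where
  "Q_point \<U> \<longleftrightarrow> is_ultrafilter \<U> \<and>
     (\<forall>Q :: nat \<Rightarrow> nat set. partition_on UNIV (range Q) \<and> (\<forall>n. finite (Q n)) \<longrightarrow>
        (\<exists>A. (\<forall>\<^sub>F n in \<U>. n \<in> A) \<and> (\<forall>n. card (A \<inter> Q n) \<le> 1)))"

end

theory Submission
  imports Defs "HOL-Analysis.Abstract_Topology_2" "HOL-Library.Discrete_Functions"
begin

text \<open>Split \<open>\<omega>\<close> into finite blocks of unbounded size and call a set thick if its traces on the blocks
  have unbounded cardinality. The sets that are not thick form an ideal containing every selector of
  the blocks, so an ultrafilter consisting of thick sets is not a Q-point. Going through all
  \<open>f : \<omega> \<rightarrow> \<omega>\<close> in order type \<open>\<cc>\<close>, one adds a set \<open>U f\<close> with \<open>f[U f] \<in> \<W>\<close>, keeping all finite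
  intersections thick. Either the preimage of some finite set can be added, or Martin's axiom applies
  to the finite sets \<open>s\<close> for which \<open>f[s]\<close> has no three-term progression. Conditions extend because only
  finitely many values complete a progression with \<open>f[s]\<close>: inside a large trace \<open>f\<close> is constant on
  many points, or takes so many values that new points can be chosen greedily.\<close>

section \<open>Cardinalities below the continuum\<close>

text \<open>Every finite subset is the set of entries of a list. Lists of length \<open>n\<close>
  are bounded by \<open>A\<close>, by induction from \<open>A \<times> A \<lesssim> A\<close>, and
  countably many lengths add nothing.\<close>

lemma finite_subsets_lepoll:
  assumes "infinite A"
  shows "{X. finite X \<and> X \<subseteq> A} \<lesssim> A"
proof -
  define L where "L n = {xs \<in> lists A. length xs = n}" for n
  have sq: "A \<times> A \<lesssim> A"
    using card_of_Times_same_infinite[OF assms] ordIso_iff_ordLeq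
    by (auto simp: lepoll_def card_of_ordLeq)
  have nat: "(UNIV :: nat set) \<lesssim> A"
    using assms by (simp add: infinite_le_lepoll)
  have L: "L n \<lesssim> A" for n
  proof (induction n)
    case 0
    have "L 0 = {[]}" by (auto simp: L_def)
    then show ?case
      using assms by (simp add: finite_lepoll_infinite)
  next
    case (Suc n)
    have "L (Suc n) = (\<lambda>(x, xs). x # xs) ` (A \<times> L n)"
      by (auto simp: L_def length_Suc_conv image_iff)
    then have "L (Suc n) \<lesssim> A \<times> L n" by (simp add: image_lepoll)
    also have "\<dots> \<lesssim> A \<times> A" using Suc by (intro times_lepoll_mono) auto
    also note sq
    finally show ?case .
  qed
  have "{X. finite X \<and> X \<subseteq> A} \<subseteq> set ` (\<Union>n. L n)"
    unfolding L_def by (auto simp: image_iff) (metis finite_list in_listsI subset_code(1))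
  then have "{X. finite X \<and> X \<subseteq> A} \<lesssim> (\<Union>n. L n)" by (rule subset_image_lepoll)
  also have "\<dots> \<lesssim> A"
    using card_of_UNION_ordLeq_infinite[OF assms, of UNIV L] L nat
    by (auto simp: lepoll_def card_of_ordLeq)
  finally show ?thesis .
qed

text \<open>Bounds the number of dense sets in the forcing step, which are indexed by a finite
  subfamily and a size. For finite \<open>A\<close> the index set is only countable, so Cantor's
  theorem suffices.\<close>

lemma finite_subsets_times_nat_lesspoll:
  assumes "A \<prec> (UNIV :: real set)"
  shows "{X. finite X \<and> X \<subseteq> A} \<times> (UNIV :: nat set) \<prec> (UNIV :: real set)"
proof (cases "finite A")
  case True
  then have "finite {X. finite X \<and> X \<subseteq> A}"
    by (rule rev_finite_subset[OF finite_Pow_iff[THEN iffD2]]) auto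
  then have c: "countable ({X. finite X \<and> X \<subseteq> A} \<times> (UNIV :: nat set))"
    by (auto intro: countable_finite)
  have "(UNIV :: nat set) \<prec> (UNIV :: nat set set)"
    using lesspoll_Pow_self[of "UNIV :: nat set"] by simp
  then have "(UNIV :: nat set) \<prec> (UNIV :: real set)"
    using nat_sets_eqpoll_reals lesspoll_eq_trans by blast
  moreover have "{X. finite X \<and> X \<subseteq> A} \<times> (UNIV :: nat set) \<lesssim> (UNIV :: nat set)"
    using c by (auto simp: countable_def lepoll_def)
  ultimately show ?thesis by (rule lesspoll_trans1[rotated])
next
  case False
  have "{X. finite X \<and> X \<subseteq> A} \<times> (UNIV :: nat set) \<lesssim> A \<times> A"
    using False by (intro times_lepoll_mono finite_subsets_lepoll) (simp_all add: infinite_le_lepoll)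
  also have "\<dots> \<lesssim> A"
    using card_of_Times_same_infinite[OF False] ordIso_iff_ordLeq
    by (auto simp: lepoll_def card_of_ordLeq)
  finally show ?thesis using assms lesspoll_trans1 by blast
qed

lemma nat_fun_lepoll_real: "(UNIV :: (nat \<Rightarrow> nat) set) \<lesssim> (UNIV :: real set)"
proof -
  \<comment> \<open>A function is coded by its graph, seen as a set of naturals.\<close>
  have "inj (\<lambda>f :: nat \<Rightarrow> nat. range (\<lambda>n. prod_encode (n, f n)))"
  proof (rule injI, rule ext)
    fix f g :: "nat \<Rightarrow> nat" and n
    assume "range (\<lambda>n. prod_encode (n, f n)) = range (\<lambda>n. prod_encode (n, g n))"
    then have "prod_encode (n, f n) \<in> range (\<lambda>n. prod_encode (n, g n))" by blast
    then show "f n = g n" by auto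
  qed
  then have "(UNIV :: (nat \<Rightarrow> nat) set) \<lesssim> (UNIV :: nat set set)"
    unfolding lepoll_def by blast
  then show ?thesis using nat_sets_eqpoll_reals lepoll_trans2 by blast
qed

section \<open>Sets without three-term progressions\<close>

definition AP3_free :: "nat set \<Rightarrow> bool" where
  "AP3_free S \<longleftrightarrow> (\<forall>a d. d > 0 \<longrightarrow> \<not> (a \<in> S \<and> a + d \<in> S \<and> a + 2 * d \<in> S))"

text \<open>Contains every outer term and midpoint completing two points of \<open>S\<close> to a
  progression. Truncated subtraction and rounding may add further values; forbidding too much does
  no harm. The pairs with \<open>x = y\<close> contribute \<open>S\<close> itself.\<close>

definition AP3_completion :: "nat set \<Rightarrow> nat set" where
  "AP3_completion S = (\<lambda>(x, y). 2 * y - x) ` (S \<times> S) \<union> (\<lambda>(x, y). (x + y) div 2) ` (S \<times> S)"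

lemma AP3_free_imp_vdW_ideal:
  assumes "AP3_free S"
  shows "S \<in> vdW_ideal"
proof -
  have "\<not> AP_set S"
  proof
    assume "AP_set S"
    then obtain a d where d: "d > 0" and *: "\<And>i. i < 3 \<Longrightarrow> a + i * d \<in> S"
      unfolding AP_set_def by blast
    have "a \<in> S" "a + d \<in> S" "a + 2 * d \<in> S" using *[of 0] *[of 1] *[of 2] by simp_all
    then show False using assms d unfolding AP3_free_def by blast
  qed
  then show ?thesis by (simp add: vdW_ideal_def)
qed

lemma finite_in_vdW_ideal:
  assumes "finite S"
  shows "S \<in> vdW_ideal"
proof -
  obtain N where N: "\<forall>x\<in>S. x < N" using assms finite_nat_set_iff_bounded by blast
  have "\<not> AP_set S"
  proof
    assume "AP_set S"
    then obtain a d where d: "d > 0" and *: "\<forall>i<Suc N. a + i * d \<in> S"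
      unfolding AP_set_def by blast
    \<comment> \<open>A progression of \<open>N + 1\<close> terms with positive difference is too
      long to stay below \<open>N\<close>.\<close>
    then have "a + N * d < N" using N by blast
    moreover have "N \<le> N * d" using d by simp
    ultimately show False by linarith
  qed
  then show ?thesis by (simp add: vdW_ideal_def)
qed

lemma subset_AP3_completion: "S \<subseteq> AP3_completion S"
  by (force simp: AP3_completion_def)

lemma finite_AP3_completion: "finite S \<Longrightarrow> finite (AP3_completion S)"
  by (simp add: AP3_completion_def)

lemma card_AP3_completion_le:
  assumes "finite S"
  shows "card (AP3_completion S) \<le> 2 * (card S)\<^sup>2"
proof -
  have "card (g ` (S \<times> S)) \<le> (card S)\<^sup>2" for g :: "nat \<times> nat \<Rightarrow> nat"
    using card_image_le[of "S \<times> S" g] assms by (simp add: card_cartesian_product power2_eq_square)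
  then show ?thesis
    unfolding AP3_completion_def mult_2 by (meson add_mono card_Un_le le_trans)
qed

text \<open>In a new progression \<open>z\<close> is the first, middle or last term; as
  \<open>d > 0\<close>, the other two terms lie in \<open>S\<close> and determine
  \<open>z\<close>.\<close>

lemma AP3_free_insert:
  assumes "AP3_free S" "z \<notin> AP3_completion S"
  shows "AP3_free (insert z S)"
  unfolding AP3_free_def
proof (intro allI impI notI, elim conjE)
  fix a d :: nat
  assume d: "d > 0" and *: "a \<in> insert z S" "a + d \<in> insert z S" "a + 2 * d \<in> insert z S"
  have z: "z \<noteq> 2 * y - x" "z \<noteq> (x + y) div 2" if "x \<in> S" "y \<in> S" for x y
    using assms(2) that by (auto simp: AP3_completion_def image_iff)
  consider "a = z" | "a + d = z" | "a + 2 * d = z" | "a \<in> S" "a + d \<in> S" "a + 2 * d \<in> S"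
    using * by auto
  then show False
  proof cases
    case 1
    then show False using * d z(1)[of "a + 2 * d" "a + d"] by auto
  next
    case 2
    then show False using * d z(2)[of a "a + 2 * d"] by auto
  next
    case 3
    then show False using * d z(1)[of a "a + d"] by auto
  next
    case 4
    then show False using assms(1) d by (auto simp: AP3_free_def)
  qed
qed

text \<open>Points are chosen one at a time. The values present so far forbid only quadratically
  many new values, each taken at most \<open>m\<close> times on \<open>T\<close>, so fewer than
  \<open>card T\<close> points are blocked.\<close>

lemma greedy_AP3_free:
  fixes f :: "'a \<Rightarrow> nat"
  assumes "finite T" "finite S" "AP3_free S"
    and fib: "\<And>v. card (T \<inter> f -` {v}) \<le> m"
    and "m * (2 * (card S + j)\<^sup>2) < card T"
  shows "\<exists>t\<subseteq>T. card t = j \<and> AP3_free (S \<union> f ` t)"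
  using assms(5)
proof (induction j)
  case 0
  then show ?case using assms(3) by (intro exI[of _ "{}"]) simp
next
  case (Suc j)
  have "m * (2 * (card S + j)\<^sup>2) \<le> m * (2 * (card S + Suc j)\<^sup>2)"
    by (intro mult_left_mono power_mono) auto
  then obtain t where t: "t \<subseteq> T" "card t = j" "AP3_free (S \<union> f ` t)"
    using Suc le_less_trans by blast
  have fin: "finite t" using t assms(1) finite_subset by blast
  define C where "C = AP3_completion (S \<union> f ` t)"
  have finC: "finite C" unfolding C_def using fin assms(2) by (simp add: finite_AP3_completion)
  have "card (S \<union> f ` t) \<le> card S + Suc j"
    using card_Un_le[of S "f ` t"] card_image_le[OF fin, of f] t by linarith
  then have "2 * (card (S \<union> f ` t))\<^sup>2 \<le> 2 * (card S + Suc j)\<^sup>2"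
    by (simp add: power_mono del: add_Suc_right)
  then have cardC: "card C \<le> 2 * (card S + Suc j)\<^sup>2"
    unfolding C_def using fin assms(2)
    by (intro order_trans[OF card_AP3_completion_le]) auto
  have eq: "T \<inter> f -` C = (\<Union>v\<in>C. T \<inter> f -` {v})" by auto
  have "card (T \<inter> f -` C) \<le> (\<Sum>v\<in>C. card (T \<inter> f -` {v}))"
    unfolding eq by (rule card_UN_le[OF finC])
  also have "\<dots> \<le> m * card C"
    using sum_bounded_above[of C "\<lambda>v. card (T \<inter> f -` {v})" m] fib by (simp add: mult.commute)
  also have "\<dots> \<le> m * (2 * (card S + Suc j)\<^sup>2)" using cardC by (rule mult_left_mono) simp
  also have "\<dots> < card T" by (rule Suc.prems)
  finally obtain x where x: "x \<in> T" "f x \<notin> C"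
    by (metis Int_absorb2 less_irrefl subsetI vimageI)
  have "x \<notin> t" using x subset_AP3_completion[of "S \<union> f ` t"] unfolding C_def by blast
  moreover have "AP3_free (S \<union> f ` insert x t)"
    using AP3_free_insert[OF t(3)] x unfolding C_def by simp
  ultimately show ?case using t x fin by (intro exI[of _ "insert x t"]) auto
qed

section \<open>Sets meeting the fibres of a map unboundedly\<close>

text \<open>The blocks are encoded as the fibres of \<open>q\<close>. Since \<open>card\<close> is 0
  on infinite sets, finiteness of the fibres is assumed wherever monotonicity is needed.\<close>

definition thick :: "('a \<Rightarrow> 'b) \<Rightarrow> 'a set \<Rightarrow> bool" where
  "thick q A \<longleftrightarrow> (\<forall>m. \<exists>n. m \<le> card (A \<inter> q -` {n}))"

lemma thick_mono:
  assumes "thick q A" "A \<subseteq> B" "\<And>n. finite (q -` {n})"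
  shows "thick q B"
  unfolding thick_def
proof
  fix m
  obtain n where "m \<le> card (A \<inter> q -` {n})" using assms(1) unfolding thick_def by blast
  also have "\<dots> \<le> card (B \<inter> q -` {n})" using assms(2,3) by (intro card_mono) auto
  finally show "\<exists>n. m \<le> card (B \<inter> q -` {n})" by blast
qed

text \<open>Bounds for the traces of \<open>A\<close> and of \<open>B\<close> add up to a bound for
  the traces of the union.\<close>

lemma thick_UnD:
  assumes "thick q (A \<union> B)"
  shows "thick q A \<or> thick q B"
proof (rule ccontr)
  assume "\<not> ?thesis"
  then obtain k l where kl: "\<And>n. card (A \<inter> q -` {n}) < k" "\<And>n. card (B \<inter> q -` {n}) < l"
    unfolding thick_def by (meson not_le)
  obtain n where "k + l \<le> card ((A \<union> B) \<inter> q -` {n})"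
    using assms unfolding thick_def by blast
  also have "\<dots> \<le> card (A \<inter> q -` {n}) + card (B \<inter> q -` {n})"
    by (metis Int_Un_distrib2 card_Un_le)
  finally show False using kl[of n] by linarith
qed


lemma thick_diff_Union:
  assumes "finite \<B>" "thick q A" "\<And>n. finite (q -` {n})"
    and "\<And>B. B \<in> \<B> \<Longrightarrow> \<not> thick q B"
  shows "thick q (A - \<Union>\<B>)"
  using assms(1,4)
proof (induction \<B>)
  case empty
  then show ?case using assms(2) by simp
next
  case (insert B \<B>)
  have "thick q (A - \<Union>\<B>)" using insert by auto
  then have "thick q ((A - \<Union>(insert B \<B>)) \<union> B)"
    by (rule thick_mono[OF _ _ assms(3)]) auto
  then show ?case using thick_UnD insert.prems by blast
qed

text \<open>On a large trace, either \<open>f\<close> takes one value more than \<open>m\<close>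
  times, and then \<open>m\<close> such points add a single value, or all fibres are small and the
  greedy choice applies.\<close>

lemma thick_obtain_AP3_free:
  fixes f :: "'a \<Rightarrow> nat"
  assumes thick: "thick q A" and "\<And>n. finite (q -` {n})"
    and S: "finite S" "AP3_free S" and avoid: "A \<inter> f -` AP3_completion S = {}"
  obtains t n where "t \<subseteq> A \<inter> q -` {n}" "card t = m" "AP3_free (S \<union> f ` t)"
proof -
  \<comment> \<open>The size is what \<open>greedy_AP3_free\<close> needs with \<open>m\<close> both
    as fibre bound and as number of points.\<close>
  obtain n where n: "Suc (m * (2 * (card S + m)\<^sup>2)) \<le> card (A \<inter> q -` {n})"
    using thick unfolding thick_def by blast
  let ?T = "A \<inter> q -` {n}"
  have fin: "finite ?T" using assms(2) by blast
  show thesis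
  proof (cases "\<exists>v. m < card (?T \<inter> f -` {v})")
    case True
    then obtain v where v: "m < card (?T \<inter> f -` {v})" by blast
    then have "?T \<inter> f -` {v} \<noteq> {}" by (intro notI) simp
    then obtain x where "x \<in> ?T" "f x = v" by blast
    then have "AP3_free (insert v S)" using avoid S by (auto intro: AP3_free_insert)
    moreover obtain t where t: "t \<subseteq> ?T \<inter> f -` {v}" "card t = m"
      using v obtain_subset_with_card_n by (metis less_imp_le)
    moreover have "S \<union> f ` t \<subseteq> insert v S" using t by auto
    ultimately have "AP3_free (S \<union> f ` t)" unfolding AP3_free_def by blast
    then show thesis using that[of t n] t by auto
  next
    case False
    then have "\<exists>t\<subseteq>?T. card t = m \<and> AP3_free (S \<union> f ` t)"
      using n by (intro greedy_AP3_free[OF fin S]) (auto simp: not_less)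
    then show thesis using that by auto
  qed
qed

section \<open>The forcing step\<close>

lemma extend_thick_family:
  fixes q :: "nat \<Rightarrow> 'b" and f :: "nat \<Rightarrow> nat"
  assumes MA: MA_countable and small: "\<F> \<prec> (UNIV :: real set)"
    and fib: "\<And>n. finite (q -` {n})"
    and thick: "\<And>X. finite X \<Longrightarrow> X \<subseteq> \<F> \<Longrightarrow> thick q (\<Inter>X)"
  shows "\<exists>U. f ` U \<in> vdW_ideal \<and> (\<forall>X. finite X \<and> X \<subseteq> \<F> \<longrightarrow> thick q (U \<inter> \<Inter>X))"
proof (cases "\<exists>V. finite V \<and> (\<forall>X. finite X \<and> X \<subseteq> \<F> \<longrightarrow> thick q (f -` V \<inter> \<Inter>X))")
  case True
  then obtain V where V: "finite V" "\<forall>X. finite X \<and> X \<subseteq> \<F> \<longrightarrow> thick q (f -` V \<inter> \<Inter>X)" by blast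
  have "f ` (f -` V) \<in> vdW_ideal"
    using V(1) by (intro finite_in_vdW_ideal) (auto intro: finite_subset)
  then show ?thesis using V(2) by blast
next
  case False
  have avoid: "thick q (\<Inter>X - f -` V)" if X: "finite X" "X \<subseteq> \<F>" and "finite V" for X V
  proof -
    obtain Y where Y: "finite Y" "Y \<subseteq> \<F>" "\<not> thick q (f -` V \<inter> \<Inter>Y)"
      using False \<open>finite V\<close> by blast
    \<comment> \<open>The witness \<open>Y\<close> against \<open>V\<close> may differ from
      \<open>X\<close>; over \<open>X \<union> Y\<close> the intersection is thick while its part in
      the preimage of \<open>V\<close> is not.\<close>
    have "\<not> thick q (\<Inter>(X \<union> Y) \<inter> f -` V)"
      using Y(3) thick_mono[OF _ _ fib, of "\<Inter>(X \<union> Y) \<inter> f -` V" "f -` V \<inter> \<Inter>Y"] by auto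
    moreover have "thick q (\<Inter>(X \<union> Y))" using X Y by (intro thick) auto
    ultimately have "thick q (\<Inter>(X \<union> Y) - f -` V)"
      using thick_UnD[of q "\<Inter>(X \<union> Y) - f -` V" "\<Inter>(X \<union> Y) \<inter> f -` V"] by (simp add: Un_Diff_Int)
    then show ?thesis by (rule thick_mono[OF _ _ fib]) auto
  qed
  \<comment> \<open>Conditions are finite approximations to \<open>U\<close>, and a larger set is a
    stronger condition. \<open>D (X, m)\<close> asks for \<open>m\<close> points of the intersection
    of \<open>X\<close> in one block.\<close>
  define P where "P = {s. finite s \<and> AP3_free (f ` s)}"
  define r where "r = {(s, t). s \<in> P \<and> t \<in> P \<and> t \<subseteq> s}"
  define D where "D = (\<lambda>(X, m). {s \<in> P. \<exists>n. m \<le> card (s \<inter> \<Inter>X \<inter> q -` {n})})"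
  define I where "I = {X. finite X \<and> X \<subseteq> \<F>} \<times> (UNIV :: nat set)"
  have "countable P"
    unfolding P_def by (rule countable_subset[OF _ countable_Collect_finite]) auto
  moreover have "{} \<in> P" unfolding P_def AP3_free_def by simp
  moreover have "partial_order_on P r"
    unfolding order_on_defs
    by (intro conjI refl_onI transI antisymI) (auto simp: r_def)
  ultimately have "MA_poset P r" by (intro MA_countable_poset[OF MA]) auto
  moreover have "D ` I \<prec> (UNIV :: real set)"
    using finite_subsets_times_nat_lesspoll[OF small] image_lepoll lesspoll_trans1
    unfolding I_def by blast
  moreover have "poset_dense P r (D (X, m))" if X: "finite X" "X \<subseteq> \<F>" for X m
    unfolding poset_dense_def
  proof (intro conjI ballI)
    show "D (X, m) \<subseteq> P" unfolding D_def by auto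
    fix s assume s: "s \<in> P"
    then have fs: "finite (f ` s)" "AP3_free (f ` s)" unfolding P_def by auto
    obtain t n where t: "t \<subseteq> (\<Inter>X - f -` AP3_completion (f ` s)) \<inter> q -` {n}"
      "card t = m" "AP3_free (f ` s \<union> f ` t)"
      using thick_obtain_AP3_free[OF avoid[OF X finite_AP3_completion[OF fs(1)]] fib fs, where m = m]
      by blast
    have "finite t" using t(1) fib by (meson finite_subset le_infE)
    then have P: "s \<union> t \<in> P" using s t(3) unfolding P_def by (simp add: image_Un)
    have "card t \<le> card ((s \<union> t) \<inter> \<Inter>X \<inter> q -` {n})"
      using t(1) fib by (intro card_mono) auto
    then have "s \<union> t \<in> D (X, m)" using P t(2) unfolding D_def by auto
    moreover have "(s \<union> t, s) \<in> r" using P s unfolding r_def by auto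
    ultimately show "\<exists>d\<in>D (X, m). (d, s) \<in> r" by blast
  qed
  then have "\<forall>E\<in>D ` I. poset_dense P r E" unfolding I_def by auto
  ultimately obtain G where G: "poset_filter P r G" and meet: "\<forall>E\<in>D ` I. G \<inter> E \<noteq> {}"
    unfolding MA_poset_def by blast
  \<comment> \<open>Directedness of \<open>G\<close> puts the three preimages of a progression into
    one condition, whose image has no such progression.\<close>
  have two: "\<exists>s\<in>G. x \<union> y \<subseteq> s" if "x \<in> G" "y \<in> G" for x y
  proof -
    obtain s where "s \<in> G" "(s, x) \<in> r" "(s, y) \<in> r"
      using G \<open>x \<in> G\<close> \<open>y \<in> G\<close> unfolding poset_filter_def by blast
    then show ?thesis unfolding r_def by blast
  qed
  have "AP3_free (f ` \<Union>G)"
    unfolding AP3_free_def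
  proof (intro allI impI notI, elim conjE)
    fix a d :: nat
    assume d: "d > 0" and "a \<in> f ` \<Union>G" "a + d \<in> f ` \<Union>G" "a + 2 * d \<in> f ` \<Union>G"
    then obtain s t u where stu: "s \<in> G" "t \<in> G" "u \<in> G" "a \<in> f ` s" "a + d \<in> f ` t" "a + 2 * d \<in> f ` u"
      by auto
    obtain v where v: "v \<in> G" "s \<union> t \<subseteq> v" using two[OF stu(1,2)] by blast
    obtain w where w: "w \<in> G" "v \<union> u \<subseteq> w" using two[OF v(1) stu(3)] by blast
    have "w \<in> P" using w G unfolding poset_filter_def by blast
    then have "AP3_free (f ` w)" unfolding P_def by simp
    moreover have "s \<subseteq> w" "t \<subseteq> w" "u \<subseteq> w" using v(2) w(2) by auto
    then have "a \<in> f ` w" "a + d \<in> f ` w" "a + 2 * d \<in> f ` w"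
      using stu(4-6) image_mono subsetD by metis+
    ultimately show False using d unfolding AP3_free_def by blast
  qed
  moreover have "thick q (\<Union>G \<inter> \<Inter>X)" if X: "finite X" "X \<subseteq> \<F>" for X
    unfolding thick_def
  proof
    fix m
    have "(X, m) \<in> I" using X unfolding I_def by simp
    then have "G \<inter> D (X, m) \<noteq> {}" using meet by blast
    then obtain s n where s: "s \<in> G" "m \<le> card (s \<inter> \<Inter>X \<inter> q -` {n})"
      unfolding D_def by auto
    have "card (s \<inter> \<Inter>X \<inter> q -` {n}) \<le> card (\<Union>G \<inter> \<Inter>X \<inter> q -` {n})"
      using s(1) fib by (intro card_mono) auto
    then show "\<exists>n. m \<le> card (\<Union>G \<inter> \<Inter>X \<inter> q -` {n})" using s(2) le_trans by blast
  qed
  ultimately show ?thesis using AP3_free_imp_vdW_ideal by blast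
qed

text \<open>Transfinite recursion over all functions, with \<open>extend_thick_family\<close>
  applied at each stage to the sets chosen earlier.\<close>

lemma thick_family:
  fixes q :: "nat \<Rightarrow> 'b"
  assumes MA: MA_countable and fib: "\<And>n. finite (q -` {n})" and thick: "thick q UNIV"
  obtains U :: "(nat \<Rightarrow> nat) \<Rightarrow> nat set"
  where "\<And>f. f ` U f \<in> vdW_ideal" "\<And>X. finite X \<Longrightarrow> thick q (\<Inter>f\<in>X. U f)"
proof -
  \<comment> \<open>A cardinal well-order has proper initial segments of smaller cardinality, so
    fewer than continuum many sets precede each stage.\<close>
  define r where "r = card_of (UNIV :: (nat \<Rightarrow> nat) set)"
  have F: "Field r = UNIV" unfolding r_def by (rule Field_card_of)
  have wo: "Well_order r" unfolding r_def by (rule card_of_Well_order)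
  define R where "R = r - Id"
  have wf: "wf R" using wo unfolding R_def by (simp add: well_order_on_def)
  have trans: "trans r" using wo by (simp add: order_on_defs)
  have tot: "(x, y) \<in> r \<or> (y, x) \<in> r" for x y
    using wo F by (cases "x = y") (auto simp: order_on_defs total_on_def refl_on_def)
  have under: "{g. (g, f) \<in> R} \<prec> (UNIV :: real set)" for f
  proof -
    have "ordLess2 (card_of (underS r f)) r"
      unfolding r_def by (rule card_of_underS[OF card_of_Card_order]) (simp add: Field_card_of)
    moreover have "underS r f = {g. (g, f) \<in> R}" unfolding underS_def R_def by auto
    ultimately have "{g. (g, f) \<in> R} \<prec> (UNIV :: (nat \<Rightarrow> nat) set)"
      unfolding r_def lesspoll_def lepoll_def eqpoll_iff_card_of_ordIso card_of_ordLeq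
      by (metis ordLess_imp_ordLeq not_ordLess_ordIso)
    then show ?thesis using nat_fun_lepoll_real lesspoll_trans2 by blast
  qed
  have maxi: "\<exists>f\<in>X. \<forall>g\<in>X. g = f \<or> (g, f) \<in> R" if "finite X" "X \<noteq> {}" for X
    using that
  proof (induction rule: finite_ne_induct)
    case (insert x Y)
    then obtain f where f: "f \<in> Y" "\<forall>g\<in>Y. g = f \<or> (g, f) \<in> R" by blast
    show ?case
    proof (cases "(x, f) \<in> r")
      case True
      then show ?thesis using f unfolding R_def by auto
    next
      case False
      then have "(f, x) \<in> r" using tot by blast
      then have "\<forall>g\<in>Y. (g, x) \<in> r" using f(2) trans unfolding R_def by (auto dest: transD)
      then show ?thesis unfolding R_def by auto
    qed
  qed simp
  \<comment> \<open>The candidate \<open>u\<close> is kept apart from \<open>U f\<close>, the form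
    that \<open>dependent_wf_choice\<close> requires; \<open>U\<close> is read only strictly below
    \<open>f\<close>.\<close>
  define Good where "Good U f u \<longleftrightarrow> f ` u \<in> vdW_ideal \<and>
    (\<forall>X. finite X \<and> X \<subseteq> {g. (g, f) \<in> R} \<longrightarrow> thick q (u \<inter> (\<Inter>g\<in>X. U g)))" for U f u
  have fip: "thick q (\<Inter>g\<in>X. U g)" if X: "finite X" and good: "\<And>g. g \<in> X \<Longrightarrow> Good U g (U g)" for X U
  proof (cases "X = {}")
    case True
    then show ?thesis using thick by simp
  next
    case False
    \<comment> \<open>The last index of \<open>X\<close> carries the claim: its requirement covers
      all finite sets of earlier indices.\<close>
    then obtain f where f: "f \<in> X" "\<forall>g\<in>X. g = f \<or> (g, f) \<in> R" using maxi X by blast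
    have "thick q (U f \<inter> (\<Inter>g\<in>X - {f}. U g))"
      using good[OF f(1)] f(2) X unfolding Good_def by auto
    moreover have "U f \<inter> (\<Inter>g\<in>X - {f}. U g) = (\<Inter>g\<in>X. U g)" using f(1) by auto
    ultimately show ?thesis by simp
  qed
  have "\<exists>U. \<forall>f. Good U f (U f)"
  proof (rule dependent_wf_choice[OF wf])
    fix U V :: "(nat \<Rightarrow> nat) \<Rightarrow> nat set" and f u
    assume eq: "\<And>g. (g, f) \<in> R \<Longrightarrow> U g = V g"
    have "(\<Inter>g\<in>X. U g) = (\<Inter>g\<in>X. V g)" if "X \<subseteq> {g. (g, f) \<in> R}" for X
      using that eq by (intro INF_cong) auto
    then have "thick q (u \<inter> (\<Inter>g\<in>X. U g)) \<longleftrightarrow> thick q (u \<inter> (\<Inter>g\<in>X. V g))"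
      if "X \<subseteq> {g. (g, f) \<in> R}" for X using that by presburger
    then show "Good U f u = Good V f u" unfolding Good_def by blast
  next
    fix f and U :: "(nat \<Rightarrow> nat) \<Rightarrow> nat set"
    assume good: "\<And>g. (g, f) \<in> R \<Longrightarrow> Good U g (U g)"
    let ?F = "U ` {g. (g, f) \<in> R}"
    have "?F \<prec> (UNIV :: real set)" using under image_lepoll lesspoll_trans1 by blast
    moreover have "thick q (\<Inter>X)" if X: "finite X" "X \<subseteq> ?F" for X
    proof -
      obtain Y where Y: "Y \<subseteq> {g. (g, f) \<in> R}" "finite Y" "X = U ` Y"
        using finite_subset_image[OF X] by blast
      have "thick q (\<Inter>g\<in>Y. U g)" using Y(1) good by (intro fip[OF Y(2)]) blast
      then show ?thesis using Y(3) by simp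
    qed
    ultimately have "\<exists>u. f ` u \<in> vdW_ideal \<and>
        (\<forall>X. finite X \<and> X \<subseteq> ?F \<longrightarrow> thick q (u \<inter> \<Inter>X))"
      by (intro extend_thick_family[OF MA _ fib])
    then obtain u where "f ` u \<in> vdW_ideal"
      and u: "\<And>X. finite X \<Longrightarrow> X \<subseteq> ?F \<Longrightarrow> thick q (u \<inter> \<Inter>X)"
      by blast
    moreover have "thick q (u \<inter> (\<Inter>g\<in>X. U g))" if "finite X" "X \<subseteq> {g. (g, f) \<in> R}" for X
      using that by (intro u) auto
    ultimately show "\<exists>u. Good U f u" unfolding Good_def by blast
  qed
  then obtain U where good: "\<And>f. Good U f (U f)" by blast
  then have "f ` U f \<in> vdW_ideal" for f unfolding Good_def by blast
  moreover have "thick q (\<Inter>f\<in>X. U f)" if "finite X" for X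
    using that good by (rule fip)
  ultimately show thesis by (intro that)
qed

section \<open>Extension to an ultrafilter\<close>

text \<open>In the order of filters, finer means smaller, so Zorn's lemma is applied to the reversed
  order and yields a minimal proper filter below \<open>F\<close>.\<close>

lemma ultrafilter_extension:
  fixes F :: "'a filter"
  assumes "F \<noteq> bot"
  obtains \<U> where "is_ultrafilter \<U>" "\<U> \<le> F"
proof -
  define A where "A = {G. G \<noteq> bot \<and> G \<le> F}"
  have "\<exists>M\<in>A. \<forall>G\<in>A. G \<le> M \<longrightarrow> G = M"
  proof (rule predicate_Zorn)
    show "partial_order_on A (relation_of (\<ge>) A)"
      unfolding order_on_defs
      by (intro conjI refl_onI transI antisymI) (auto simp: relation_of_def)
  next
    fix C assume C: "C \<in> Chains (relation_of (\<ge>) A)"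
    then have CA: "C \<subseteq> A" by (rule Chains_relation_of)
    have lin: "G \<le> H \<or> H \<le> G" if "G \<in> C" "H \<in> C" for G H
      using C that unfolding Chains_def relation_of_def by auto
    show "\<exists>L\<in>A. \<forall>G\<in>C. L \<le> G"
    proof (cases "C = {}")
      case True
      then show ?thesis using assms unfolding A_def by auto
    next
      case False
      \<comment> \<open>On a chain, an event of the infimum already holds in some member, so the
        infimum stays proper.\<close>
      have "eventually P (Inf C) \<longleftrightarrow> (\<exists>G\<in>C. eventually P G)" for P
        using False lin by (intro eventually_Inf_base) (auto simp: le_inf_iff)
      then have "Inf C \<noteq> bot" using CA unfolding A_def trivial_limit_def by blast
      moreover have "Inf C \<le> F" using False CA unfolding A_def by (auto intro: Inf_lower2)
      ultimately show ?thesis unfolding A_def by (auto intro: Inf_lower)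
    qed
  qed
  then obtain M where M: "M \<noteq> bot" "M \<le> F" and max: "\<And>G. G \<noteq> bot \<Longrightarrow> G \<le> M \<Longrightarrow> G = M"
    unfolding A_def by (auto intro: order_trans)
  have "(\<forall>\<^sub>F x in M. x \<in> B) \<or> (\<forall>\<^sub>F x in M. x \<in> - B)" for B
  \<comment> \<open>Restricting \<open>M\<close> to \<open>B\<close> gives either the improper
    filter, so that the complement of \<open>B\<close> belongs to \<open>M\<close>, or
    \<open>M\<close> itself by minimality.\<close>
  proof (cases "inf M (principal B) = bot")
    case True
    then show ?thesis
      by (auto simp: trivial_limit_def eventually_inf_principal)
  next
    case False
    then have "inf M (principal B) = M" by (intro max) auto
    then have "M \<le> principal B" by (simp add: le_iff_inf)
    then show ?thesis by (auto simp: le_principal)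
  qed
  then show thesis using that M unfolding is_ultrafilter_def by blast
qed

theorem theorem2p4:
  assumes MA_countable
  shows "\<exists>\<U> :: nat filter. W_ultrafilter \<U> \<and> \<not> Q_point \<U>"
proof -
  \<comment> \<open>The blocks are the intervals between consecutive squares; block \<open>n\<close>
    has \<open>2 * n + 1\<close> points.\<close>
  define q where "q = floor_sqrt"
  have q: "q -` {n} = {n\<^sup>2..<(Suc n)\<^sup>2}" for n
  proof -
    have "q x = n \<longleftrightarrow> n \<le> q x \<and> \<not> Suc n \<le> q x" for x by linarith
    then have "q x = n \<longleftrightarrow> n\<^sup>2 \<le> x \<and> x < (Suc n)\<^sup>2" for x
      unfolding q_def le_floor_sqrt_iff not_le .
    then show ?thesis by (simp add: set_eq_iff)
  qed
  have fib: "finite (q -` {n})" for n by (simp add: q)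
  have "n\<^sup>2 \<in> q -` {n}" for n by (simp add: q power2_eq_square)
  then have nonempty: "q -` {n} \<noteq> {}" for n by blast
  have "m \<le> card (UNIV \<inter> q -` {m})" for m by (simp add: q power2_eq_square)
  then have "thick q UNIV" unfolding thick_def by blast
  then obtain U :: "(nat \<Rightarrow> nat) \<Rightarrow> nat set"
    where W: "\<And>f. f ` U f \<in> vdW_ideal" and U: "\<And>X. finite X \<Longrightarrow> thick q (\<Inter>f\<in>X. U f)"
    using thick_family[OF assms fib] by blast
  \<comment> \<open>The sets \<open>U f\<close> give the \<W>-property; the complements of sets that
    are not thick keep every selector of the blocks out.\<close>
  define \<B> where "\<B> = range U \<union> uminus ` {A. \<not> thick q A}"
  have "(INF B\<in>\<B>. principal B) \<noteq> bot"
  proof (rule INF_filter_not_bot)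
    fix X assume X: "X \<subseteq> \<B>" "finite X"
    obtain Y where Y: "finite Y" "X \<inter> range U = U ` Y"
      using finite_subset_image[of "X \<inter> range U" U UNIV] X by auto
    \<comment> \<open>The remaining members of \<open>X\<close> are complements of sets that are not
      thick; removing finitely many such sets keeps the intersection of the \<open>U f\<close>
      thick, hence nonempty.\<close>
    define Z where "Z = uminus ` (X - range U)"
    have "thick q ((\<Inter>f\<in>Y. U f) - \<Union>Z)"
      using X Y by (intro thick_diff_Union[OF _ U fib]) (auto simp: Z_def \<B>_def)
    moreover have "(\<Inter>f\<in>Y. U f) - \<Union>Z \<subseteq> \<Inter>X"
      using Y(2) unfolding Z_def by blast
    moreover have "\<not> thick q {}" by (auto simp: thick_def)
    ultimately have "\<Inter>X \<noteq> {}" by (metis subset_empty)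
    then show "(INF B\<in>X. principal B) \<noteq> bot"
      using X by (simp add: INF_principal_finite principal_eq_bot_iff)
  qed
  then obtain \<U> where ultra: "is_ultrafilter \<U>" and le: "\<U> \<le> (INF B\<in>\<B>. principal B)"
    by (rule ultrafilter_extension)
  have mem: "\<forall>\<^sub>F n in \<U>. n \<in> B" if "B \<in> \<B>" for B
    using le that by (auto simp: le_INF_iff le_principal)
  have "W_ultrafilter \<U>"
    unfolding W_ultrafilter_def
  proof (intro conjI ultra allI)
    fix f show "\<exists>A. (\<forall>\<^sub>F n in \<U>. n \<in> A) \<and> f ` A \<in> vdW_ideal"
      using mem[of "U f"] W[of f] unfolding \<B>_def by blast
  qed
  moreover have "\<not> Q_point \<U>"
  proof
    assume "Q_point \<U>"
    moreover have "partition_on UNIV (range (\<lambda>n. q -` {n}))"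
      using nonempty by (intro partition_onI) (auto simp: disjnt_def)
    ultimately obtain A where A: "\<forall>\<^sub>F n in \<U>. n \<in> A" and one: "\<And>n. card (A \<inter> q -` {n}) \<le> 1"
      using fib unfolding Q_point_def by meson
    \<comment> \<open>Traces of size at most 1 refute thickness at \<open>m = 2\<close>.\<close>
    have "\<not> thick q A"
      unfolding thick_def using one by (metis Suc_1 not_less_eq_eq)
    then have "\<forall>\<^sub>F n in \<U>. n \<in> - A" by (intro mem) (auto simp: \<B>_def)
    with A have "\<forall>\<^sub>F n in \<U>. False" by eventually_elim simp
    then show False using ultra by (simp add: is_ultrafilter_def)
  qed
  ultimately show ?thesis by blast
qed

end
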